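(* Let $\mathscr{Y}$ be a $\gamma$-line graph and let $\mathscr{G}$ be a root of $\Gamma(\mathscr{Y})$. If $\mathscr{G}$ is bipartite, then there exist exactly three mixed root orientations $\mathscr{X}$ (mixed orientations of $\mathscr{G}$) such that $L_\gamma(\mathscr{X})=\mathscr{Y}$; otherwise there exists exactly one such orientation.
   Context: $\gamma=e^{2\pi i/3}$. A mixed graph is obtained from a simple undirected graph by orienting some of its edges into arcs; the unoriented edges are called digons. $\Gamma(\mathscr{D})$ denotes the underlying undirected graph of a mixed graph $\mathscr{D}$; a mixed orientation of an undirected graph $\mathscr{G}$ is a mixed graph with underlying graph $\mathscr{G}$. $L(\mathscr{G})$ is the ordinary undirected line graph. An undirected graph $\mathscr{G}$ is a root of an undirected graph $H$ if $L(\mathscr{G})=H$. A $\gamma$-line graph is a mixed graph of the form $L_\gamma(\mathscr{X}_0)$ for some mixed graph $\mathscr{X}_0$. $\gamma$-line graph $L_\gamma(\mathscr{D})$: the mixed orientation of $L(\Gamma(\mathscr{D}))$ given as follows. For distinct edges $e,f$ of $\mathscr{D}$ sharing a vertex $v$: if $e$ is an arc with head $v$ and $f$ is an arc with tail $v$, there is an arc from $e$ to $f$; if $e,f$ are both arcs with head $v$, or both arcs with tail $v$, or both digons, then $ef$ is a digon; if $e$ is an arc with head $v$ and $f$ is a digon, there is an arc from $f$ to $e$; if $e$ is an arc with tail $v$ and $f$ is a digon, there is an arc from $e$ to $f$.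
   Formalization: Γ(Y) is assumed connected and nonempty: without this the count fails (two disjoint edges admit nine orientations, not three). Root and γ-line graph equalities are read as equalities of labelled graphs, not isomorphisms. *)

theory Defs
  imports Main
begin

record 'a ugraph =
  uverts :: "'a set"
  uedges :: "'a set set"

definition simple_graph :: "'a ugraph \<Rightarrow> bool" where
  "simple_graph G \<longleftrightarrow> (\<forall>e \<in> uedges G. e \<subseteq> uverts G \<and> card e = 2)"

text \<open>The null graph does not count as connected.\<close>

definition connected_graph :: "'a ugraph \<Rightarrow> bool" where
  "connected_graph G \<longleftrightarrow> uverts G \<noteq> {} \<and>
     (\<forall>u \<in> uverts G. \<forall>v \<in> uverts G. (u, v) \<in> {(x, y). {x, y} \<in> uedges G}\<^sup>*)"

definition bipartite :: "'a ugraph \<Rightarrow> bool" where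
  "bipartite G \<longleftrightarrow> (\<exists>A B. A \<inter> B = {} \<and> A \<union> B = uverts G \<and>
     (\<forall>e \<in> uedges G. \<exists>a \<in> A. \<exists>b \<in> B. e = {a, b}))"

text \<open>The vertices of a line graph are the edges themselves, so identities such as
  \<open>line_graph G = H\<close> are equalities of labelled graphs and not isomorphisms.\<close>

definition line_graph :: "'a ugraph \<Rightarrow> 'a set ugraph" where
  "line_graph G =
     \<lparr> uverts = uedges G,
       uedges = {{e, f} | e f. e \<in> uedges G \<and> f \<in> uedges G \<and> e \<noteq> f \<and> e \<inter> f \<noteq> {}} \<rparr>"

definition is_root :: "'a ugraph \<Rightarrow> 'a set ugraph \<Rightarrow> bool" where
  "is_root G H \<longleftrightarrow> simple_graph G \<and> line_graph G = H"

text \<open>An arc \<open>(u, v)\<close> has tail \<open>u\<close> and head \<open>v\<close>; a digon is kept as an unordered pair.\<close>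

record 'a mgraph =
  mverts :: "'a set"
  digons :: "'a set set"
  arcs :: "('a \<times> 'a) set"

definition underlying :: "'a mgraph \<Rightarrow> 'a ugraph" where
  "underlying D =
     \<lparr> uverts = mverts D, uedges = digons D \<union> {{u, v} | u v. (u, v) \<in> arcs D} \<rparr>"

text \<open>Each edge of the underlying simple graph is either a digon or an arc in exactly one of
  the two directions.\<close>

definition mixed_graph :: "'a mgraph \<Rightarrow> bool" where
  "mixed_graph D \<longleftrightarrow> simple_graph (underlying D) \<and>
     (\<forall>u v. (u, v) \<in> arcs D \<longrightarrow> (v, u) \<notin> arcs D \<and> {u, v} \<notin> digons D)"

definition mixed_orientation :: "'a mgraph \<Rightarrow> 'a ugraph \<Rightarrow> bool" where
  "mixed_orientation D G \<longleftrightarrow> mixed_graph D \<and> underlying D = G"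

definition arc_with_head :: "'a mgraph \<Rightarrow> 'a set \<Rightarrow> 'a \<Rightarrow> bool" where
  "arc_with_head D e v \<longleftrightarrow> (\<exists>u. (u, v) \<in> arcs D \<and> e = {u, v})"

definition arc_with_tail :: "'a mgraph \<Rightarrow> 'a set \<Rightarrow> 'a \<Rightarrow> bool" where
  "arc_with_tail D e v \<longleftrightarrow> (\<exists>w. (v, w) \<in> arcs D \<and> e = {v, w})"

definition digon_at :: "'a mgraph \<Rightarrow> 'a set \<Rightarrow> 'a \<Rightarrow> bool" where
  "digon_at D e v \<longleftrightarrow> e \<in> digons D \<and> v \<in> e"

definition gamma_line :: "'a mgraph \<Rightarrow> 'a set mgraph" where
  "gamma_line D =
     \<lparr> mverts = uedges (underlying D),
       digons = {{e, f} | e f. e \<noteq> f \<and> (\<exists>v.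
           arc_with_head D e v \<and> arc_with_head D f v \<or>
           arc_with_tail D e v \<and> arc_with_tail D f v \<or>
           digon_at D e v \<and> digon_at D f v)},
       arcs = {(e, f). e \<noteq> f \<and> (\<exists>v.
           arc_with_head D e v \<and> arc_with_tail D f v \<or>
           digon_at D e v \<and> arc_with_head D f v \<or>
           arc_with_tail D e v \<and> digon_at D f v)} \<rparr>"

definition is_gamma_line_graph :: "'a set mgraph \<Rightarrow> bool" where
  "is_gamma_line_graph Y \<longleftrightarrow> (\<exists>X0. mixed_graph X0 \<and> Y = gamma_line X0)"

lemma mixed_graph_cases:
  assumes "mixed_graph D" "e \<in> uedges (underlying D)" "v \<in> e"
  shows "arc_with_head D e v \<or> arc_with_tail D e v \<or> digon_at D e v"
  using assms by (auto simp: underlying_def arc_with_head_def arc_with_tail_def digon_at_def)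

lemma mixed_graph_incident:
  assumes "arc_with_head D e v \<or> arc_with_tail D e v \<or> digon_at D e v"
  shows "e \<in> uedges (underlying D) \<and> v \<in> e"
  using assms by (auto simp: underlying_def arc_with_head_def arc_with_tail_def digon_at_def)

lemma mixed_graph_exclusive:
  assumes "mixed_graph D"
  shows "\<not> (arc_with_head D e v \<and> arc_with_tail D e v)"
    "\<not> (arc_with_head D e v \<and> digon_at D e v)"
    "\<not> (arc_with_tail D e v \<and> digon_at D e v)"
proof -
  have noloop: "(u, u) \<notin> arcs D" for u
  proof
    assume "(u, u) \<in> arcs D"
    then have "{u} \<in> uedges (underlying D)"
      by (force simp: underlying_def)
    then show False
      using assms by (auto simp: mixed_graph_def simple_graph_def)
  qed
  have excl: "(v, u) \<notin> arcs D" "{u, v} \<notin> digons D" if "(u, v) \<in> arcs D" for u v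
    using assms that by (simp_all add: mixed_graph_def)
  show "\<not> (arc_with_head D e v \<and> arc_with_tail D e v)"
    unfolding arc_with_head_def arc_with_tail_def using noloop excl(1) by (metis doubleton_eq_iff)
  show "\<not> (arc_with_head D e v \<and> digon_at D e v)"
    unfolding arc_with_head_def digon_at_def using excl(2) by blast
  show "\<not> (arc_with_tail D e v \<and> digon_at D e v)"
    unfolding arc_with_tail_def digon_at_def using excl(2) by blast
qed

lemma simple_graph_common_vertex:
  assumes "simple_graph G" "e \<in> uedges G" "f \<in> uedges G" "e \<noteq> f"
    "v \<in> e" "v \<in> f" "w \<in> e" "w \<in> f"
  shows "v = w"
proof (rule ccontr)
  assume "v \<noteq> w"
  have "e = {v, w}" if "card e = 2" "v \<in> e" "w \<in> e" for e
    using that \<open>v \<noteq> w\<close> by (auto simp: card_2_iff)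
  then show False
    using assms unfolding simple_graph_def by metis
qed

lemma digons_gamma_line:
  "x \<in> digons (gamma_line D) \<longleftrightarrow> (\<exists>e f v. x = {e, f} \<and> e \<noteq> f \<and>
     (arc_with_head D e v \<and> arc_with_head D f v \<or>
      arc_with_tail D e v \<and> arc_with_tail D f v \<or>
      digon_at D e v \<and> digon_at D f v))"
  unfolding gamma_line_def mgraph.simps mem_Collect_eq by blast

lemma arcs_gamma_line:
  "(e, f) \<in> arcs (gamma_line D) \<longleftrightarrow> e \<noteq> f \<and> (\<exists>v.
     arc_with_head D e v \<and> arc_with_tail D f v \<or>
     digon_at D e v \<and> arc_with_head D f v \<or>
     arc_with_tail D e v \<and> digon_at D f v)"
  by (simp add: gamma_line_def)

lemma underlying_gamma_line:
  assumes "mixed_graph D"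
  shows "underlying (gamma_line D) = line_graph (underlying D)"
proof -
  let ?E = "uedges (underlying D)"
  let ?L = "uedges (underlying (gamma_line D))"
  have complete: "{e, f} \<in> ?L" if "e \<in> ?E" "f \<in> ?E" "e \<noteq> f" "v \<in> e" "v \<in> f" for e f v
  proof -
    have c: "{e, f} \<in> digons (gamma_line D) \<or> (e, f) \<in> arcs (gamma_line D)
        \<or> (f, e) \<in> arcs (gamma_line D)"
      using mixed_graph_cases[OF assms that(1) that(4)] mixed_graph_cases[OF assms that(2) that(5)]
        that(3)
      unfolding digons_gamma_line arcs_gamma_line by blast
    then show ?thesis
      by (auto simp: underlying_def insert_commute)
  qed
  have sound: "\<exists>e f. x = {e, f} \<and> e \<in> ?E \<and> f \<in> ?E \<and> e \<noteq> f \<and> e \<inter> f \<noteq> {}"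
    if x: "x \<in> ?L" for x
  proof -
    obtain e f v where ef: "x = {e, f}" "e \<noteq> f"
      and e: "arc_with_head D e v \<or> arc_with_tail D e v \<or> digon_at D e v"
      and f: "arc_with_head D f v \<or> arc_with_tail D f v \<or> digon_at D f v"
    proof -
      have "x \<in> digons (gamma_line D) \<or> (\<exists>e f. x = {e, f} \<and> (e, f) \<in> arcs (gamma_line D))"
        using x by (auto simp: underlying_def)
      then have "\<exists>e f v. x = {e, f} \<and> e \<noteq> f \<and>
          (arc_with_head D e v \<or> arc_with_tail D e v \<or> digon_at D e v) \<and>
          (arc_with_head D f v \<or> arc_with_tail D f v \<or> digon_at D f v)"
      proof (elim disjE exE conjE)
        assume "x \<in> digons (gamma_line D)"
        then show ?thesis
          unfolding digons_gamma_line arcs_gamma_line by blast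
      next
        fix e f
        assume "x = {e, f}" "(e, f) \<in> arcs (gamma_line D)"
        then show ?thesis
          unfolding digons_gamma_line arcs_gamma_line by blast
      qed
      with that show ?thesis
        by blast
    qed
    show ?thesis
      using ef mixed_graph_incident[OF e] mixed_graph_incident[OF f] by blast
  qed
  have "?L = uedges (line_graph (underlying D))"
  proof (intro set_eqI iffI)
    fix x
    assume "x \<in> ?L"
    then show "x \<in> uedges (line_graph (underlying D))"
      using sound by (simp add: line_graph_def)
  next
    fix x
    assume "x \<in> uedges (line_graph (underlying D))"
    then obtain e f where ef: "x = {e, f}" "e \<in> ?E" "f \<in> ?E" "e \<noteq> f" and "e \<inter> f \<noteq> {}"
      unfolding line_graph_def ugraph.simps mem_Collect_eq by (elim exE conjE)
    then obtain v where "v \<in> e" "v \<in> f"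
      by blast
    then show "x \<in> ?L"
      using ef complete by simp
  qed
  moreover have "uverts (underlying (gamma_line D)) = uverts (line_graph (underlying D))"
    by (simp add: underlying_def gamma_line_def line_graph_def)
  ultimately show ?thesis
    by simp
qed

lemma mixed_orientation_gamma_line:
  assumes D: "mixed_graph D"
  shows "mixed_orientation (gamma_line D) (line_graph (underlying D))"
proof -
  let ?E = "uedges (underlying D)"
  have sg: "simple_graph (underlying D)"
    using D by (simp add: mixed_graph_def)
  have "simple_graph (line_graph (underlying D))"
    unfolding simple_graph_def
  proof
    fix x
    assume "x \<in> uedges (line_graph (underlying D))"
    then obtain e f where "x = {e, f}" "e \<in> ?E" "f \<in> ?E" "e \<noteq> f"
      unfolding line_graph_def ugraph.simps mem_Collect_eq by (elim exE conjE)
    then show "x \<subseteq> uverts (line_graph (underlying D)) \<and> card x = 2"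
      by (simp add: line_graph_def)
  qed
  moreover have "(f, e) \<notin> arcs (gamma_line D) \<and> {e, f} \<notin> digons (gamma_line D)"
    if ef: "(e, f) \<in> arcs (gamma_line D)" for e f
  proof -
    obtain v where "e \<noteq> f"
      and v: "arc_with_head D e v \<and> arc_with_tail D f v \<or> digon_at D e v \<and> arc_with_head D f v \<or>
           arc_with_tail D e v \<and> digon_at D f v"
      using ef by (auto simp: gamma_line_def)
    then have inc: "e \<in> ?E" "f \<in> ?E" "v \<in> e" "v \<in> f"
      using mixed_graph_incident by metis+
    have uniq: "w = v" if "w \<in> e" "w \<in> f" for w
      using simple_graph_common_vertex[OF sg inc(1,2) \<open>e \<noteq> f\<close> that inc(3,4)] .
    note x = mixed_graph_exclusive[OF D]
    have "(f, e) \<notin> arcs (gamma_line D)"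
    proof
      assume "(f, e) \<in> arcs (gamma_line D)"
      then obtain w where w: "arc_with_head D f w \<and> arc_with_tail D e w \<or>
          digon_at D f w \<and> arc_with_head D e w \<or> arc_with_tail D f w \<and> digon_at D e w"
        by (auto simp: gamma_line_def)
      then have "w = v" using uniq mixed_graph_incident by metis
      then show False using v w x by metis
    qed
    moreover have "{e, f} \<notin> digons (gamma_line D)"
    proof
      assume "{e, f} \<in> digons (gamma_line D)"
      then obtain w where w: "arc_with_head D e w \<and> arc_with_head D f w \<or>
          arc_with_tail D e w \<and> arc_with_tail D f w \<or> digon_at D e w \<and> digon_at D f w"
        unfolding digons_gamma_line doubleton_eq_iff by blast
      then have "w = v" using uniq mixed_graph_incident by metis
      then show False using v w x by metis
    qed
    ultimately show ?thesis ..
  qed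
  ultimately show ?thesis
    unfolding mixed_orientation_def mixed_graph_def
    using underlying_gamma_line[OF D] by simp
qed

end

theory Submission
  imports Defs
begin

text \<open>
  Record an orientation \<open>X\<close> of \<open>G\<close> by a value in \<open>\<int>/3\<close> for every incidence of an edge \<open>e\<close>
  with a vertex \<open>v\<close>: \<open>1\<close> if \<open>v\<close> is the head of \<open>e\<close>, \<open>-1\<close> if it is the tail, \<open>0\<close> if \<open>e\<close> is a digon.
  The two values on an edge sum to \<open>0\<close>, and every system of values with this property comes from
  exactly one orientation. The graph \<open>gamma_line X\<close> records precisely the differences modulo \<open>3\<close>
  of the values of two edges at a common vertex. Hence two orientations with the same
  \<open>\<gamma>\<close>-line graph differ by a function \<open>d\<close> of the vertex alone with \<open>d u = - d v\<close> along every edge.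
  By connectedness \<open>d\<close> is determined by one of its values; a nonzero \<open>d\<close> takes the values \<open>1\<close> and
  \<open>-1\<close> and so is a bipartition, while on a bipartite graph the value on one side is free.
\<close>

section \<open>Incidence values modulo 3\<close>

text \<open>The integer representatives -1, 0, 1 make the values at the two ends of an edge exact
  negatives, while distinct values stay distinct modulo 3. The value 0 is also the default when
  \<open>e\<close> is no edge or \<open>v\<close> is not on it.\<close>

definition inc_val :: "'a mgraph \<Rightarrow> 'a set \<Rightarrow> 'a \<Rightarrow> int" where
  "inc_val D e v = (if arc_with_head D e v then 1 else if arc_with_tail D e v then - 1 else 0)"

text \<open>Reading \<open>h\<close> modulo 3 allows unreduced sums of incidence values. Testing for
  heads suffices for the arcs: when the two residues on an edge cancel, residue 2 at one end means
  residue 1 at the other.\<close>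

definition orientation_of :: "'a ugraph \<Rightarrow> ('a set \<Rightarrow> 'a \<Rightarrow> int) \<Rightarrow> 'a mgraph" where
  "orientation_of G h =
     \<lparr> mverts = uverts G,
       digons = {e \<in> uedges G. \<forall>v \<in> e. h e v mod 3 = 0},
       arcs = {(u, v). {u, v} \<in> uedges G \<and> h {u, v} v mod 3 = 1} \<rparr>"

lemma inc_val_range: "inc_val D e v \<in> {-1, 0, 1}"
  by (simp add: inc_val_def)

lemma inc_val_mod_eqD: "inc_val D e v mod 3 = inc_val D' e' v' mod 3 \<Longrightarrow>
    inc_val D e v = inc_val D' e' v'"
  using inc_val_range[of D e v] inc_val_range[of D' e' v'] by auto

lemma simple_graph_edge_neq: "simple_graph G \<Longrightarrow> {u, v} \<in> uedges G \<Longrightarrow> u \<noteq> v"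
  by (auto simp: simple_graph_def)

lemma simple_graph_edgeE:
  assumes "simple_graph G" "e \<in> uedges G" "v \<in> e"
  obtains u where "e = {u, v}" "u \<noteq> v"
proof -
  have "card e = 2"
    using assms by (simp add: simple_graph_def)
  then obtain x y where "e = {x, y}" "x \<noteq> y"
    by (auto simp: card_2_iff)
  then show thesis
    using that assms(3) by (metis insert_commute insertE singletonD)
qed

section \<open>Mixed graphs and their line graphs in terms of incidence values\<close>

context
  fixes D :: "'a mgraph"
  assumes D: "mixed_graph D"
begin

lemma inc_val_eq_1_iff: "inc_val D e v = 1 \<longleftrightarrow> arc_with_head D e v"
  by (simp add: inc_val_def)

lemma inc_val_eq_minus_1_iff: "inc_val D e v = -1 \<longleftrightarrow> arc_with_tail D e v"
  using mixed_graph_exclusive[OF D] by (auto simp: inc_val_def)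

lemma inc_val_eq_0_iff:
  assumes "e \<in> uedges (underlying D)" "v \<in> e"
  shows "inc_val D e v = 0 \<longleftrightarrow> digon_at D e v"
  using mixed_graph_exclusive[OF D] mixed_graph_cases[OF D assms] by (auto simp: inc_val_def)

lemma inc_val_opposite:
  assumes "{u, v} \<in> uedges (underlying D)"
  shows "inc_val D {u, v} u = - inc_val D {u, v} v"
proof -
  have "u \<noteq> v"
    using D assms simple_graph_edge_neq unfolding mixed_graph_def by metis
  then have "arc_with_head D {u, v} u \<longleftrightarrow> arc_with_tail D {u, v} v"
    "arc_with_head D {u, v} v \<longleftrightarrow> arc_with_tail D {u, v} u"
    by (auto simp: arc_with_head_def arc_with_tail_def doubleton_eq_iff)
  then show ?thesis
    using mixed_graph_exclusive[OF D] by (auto simp: inc_val_def)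
qed

lemma arcs_iff_inc_val:
  "(u, v) \<in> arcs D \<longleftrightarrow> {u, v} \<in> uedges (underlying D) \<and> inc_val D {u, v} v = 1"
proof -
  have "u \<noteq> v" if "{u, v} \<in> uedges (underlying D)"
    using D that simple_graph_edge_neq unfolding mixed_graph_def by metis
  then show ?thesis
    unfolding inc_val_eq_1_iff
    by (auto simp: arc_with_head_def doubleton_eq_iff underlying_def)
qed

lemma digons_iff_inc_val:
  "e \<in> digons D \<longleftrightarrow> e \<in> uedges (underlying D) \<and> (\<forall>v \<in> e. inc_val D e v = 0)"
proof -
  \<comment> \<open>On an empty \<open>e\<close> the condition on all its vertices would hold
    vacuously.\<close>
  have "e \<noteq> {}" if "e \<in> uedges (underlying D)"
    using D that by (auto simp: mixed_graph_def simple_graph_def)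
  moreover have "e \<in> uedges (underlying D)" if "e \<in> digons D"
    using that by (simp add: underlying_def)
  ultimately show ?thesis
    using inc_val_eq_0_iff by (auto simp: digon_at_def)
qed

text \<open>The three defining cases are the value pairs (1, -1), (0, 1) and (-1, 0), exactly those
  in which the value grows by 1 modulo 3 from \<open>e\<close> to \<open>f\<close>.\<close>

lemma arcs_gamma_line_iff:
  "(e, f) \<in> arcs (gamma_line D) \<longleftrightarrow>
     e \<in> uedges (underlying D) \<and> f \<in> uedges (underlying D) \<and> e \<noteq> f \<and>
     (\<exists>v \<in> e \<inter> f. inc_val D f v mod 3 = (inc_val D e v + 1) mod 3)"
  (is "?L \<longleftrightarrow> ?R")
proof
  assume ?L
  then obtain v where "e \<noteq> f" and v: "arc_with_head D e v \<and> arc_with_tail D f v \<or>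
     digon_at D e v \<and> arc_with_head D f v \<or> arc_with_tail D e v \<and> digon_at D f v"
    unfolding arcs_gamma_line by blast
  then have inc: "e \<in> uedges (underlying D)" "f \<in> uedges (underlying D)" "v \<in> e" "v \<in> f"
    using mixed_graph_incident by metis+
  have "inc_val D f v mod 3 = (inc_val D e v + 1) mod 3"
    using v unfolding inc_val_eq_1_iff[symmetric] inc_val_eq_minus_1_iff[symmetric]
      inc_val_eq_0_iff[OF inc(1,3), symmetric] inc_val_eq_0_iff[OF inc(2,4), symmetric]
    by auto
  then show ?R
    using inc \<open>e \<noteq> f\<close> by blast
next
  assume ?R
  then obtain v where inc: "e \<in> uedges (underlying D)" "f \<in> uedges (underlying D)" "v \<in> e" "v \<in> f"
    and "e \<noteq> f" and v: "inc_val D f v mod 3 = (inc_val D e v + 1) mod 3"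
    by blast
  have "inc_val D e v = 1 \<and> inc_val D f v = -1 \<or> inc_val D e v = 0 \<and> inc_val D f v = 1 \<or>
    inc_val D e v = -1 \<and> inc_val D f v = 0"
    using v inc_val_range[of D e v] inc_val_range[of D f v] by auto
  then show ?L
    unfolding arcs_gamma_line inc_val_eq_1_iff inc_val_eq_minus_1_iff
      inc_val_eq_0_iff[OF inc(1,3)] inc_val_eq_0_iff[OF inc(2,4)]
    using \<open>e \<noteq> f\<close> by blast
qed

lemma digons_gamma_line_iff:
  "x \<in> digons (gamma_line D) \<longleftrightarrow>
     (\<exists>e \<in> uedges (underlying D). \<exists>f \<in> uedges (underlying D). x = {e, f} \<and> e \<noteq> f \<and>
       (\<exists>v \<in> e \<inter> f. inc_val D f v = inc_val D e v))"
  (is "?L \<longleftrightarrow> ?R")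
proof
  assume ?L
  then obtain e f v where ef: "x = {e, f}" "e \<noteq> f"
    and v: "arc_with_head D e v \<and> arc_with_head D f v \<or>
      arc_with_tail D e v \<and> arc_with_tail D f v \<or> digon_at D e v \<and> digon_at D f v"
    unfolding digons_gamma_line by blast
  then have inc: "e \<in> uedges (underlying D)" "f \<in> uedges (underlying D)" "v \<in> e" "v \<in> f"
    using mixed_graph_incident by metis+
  have "inc_val D f v = inc_val D e v"
    using v unfolding inc_val_eq_1_iff[symmetric] inc_val_eq_minus_1_iff[symmetric]
      inc_val_eq_0_iff[OF inc(1,3), symmetric] inc_val_eq_0_iff[OF inc(2,4), symmetric]
    by auto
  then show ?R
    using inc ef by blast
next
  assume ?R
  then obtain e f v where inc: "e \<in> uedges (underlying D)" "f \<in> uedges (underlying D)" "v \<in> e" "v \<in> f"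
    and ef: "x = {e, f}" "e \<noteq> f" and v: "inc_val D f v = inc_val D e v"
    by blast
  have "inc_val D e v = 1 \<and> inc_val D f v = 1 \<or> inc_val D e v = -1 \<and> inc_val D f v = -1 \<or>
    inc_val D e v = 0 \<and> inc_val D f v = 0"
    using v inc_val_range[of D e v] by auto
  then show ?L
    unfolding digons_gamma_line inc_val_eq_1_iff inc_val_eq_minus_1_iff
      inc_val_eq_0_iff[OF inc(1,3)] inc_val_eq_0_iff[OF inc(2,4)]
    using ef by blast
qed

end

section \<open>Comparison of two orientations of one graph\<close>

lemma mixed_orientation_eqI:
  assumes "mixed_orientation X G" "mixed_orientation X' G"
    and "\<And>e v. e \<in> uedges G \<Longrightarrow> v \<in> e \<Longrightarrow> inc_val X e v = inc_val X' e v"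
  shows "X = X'"
proof -
  have X: "mixed_graph X" "underlying X = G" and X': "mixed_graph X'" "underlying X' = G"
    using assms(1,2) by (auto simp: mixed_orientation_def)
  have "mverts X = mverts X'"
    using X(2) X'(2) by (auto simp: underlying_def)
  moreover have "digons X = digons X'"
    unfolding set_eq_iff digons_iff_inc_val[OF X(1)] digons_iff_inc_val[OF X'(1)] X(2) X'(2)
    using assms(3) by metis
  moreover have "arcs X = arcs X'"
    unfolding set_eq_iff split_paired_All arcs_iff_inc_val[OF X(1)] arcs_iff_inc_val[OF X'(1)]
      X(2) X'(2)
    using assms(3) by (metis insertCI)
  ultimately show ?thesis
    by simp
qed

text \<open>Arcs and digons of the line graph depend only on the difference of two values at a
  common vertex, and \<open>diff\<close> preserves these differences modulo 3.\<close>

lemma gamma_line_eqI: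
  assumes "mixed_orientation X G" "mixed_orientation X' G"
    and diff: "\<And>e f v. \<lbrakk>e \<in> uedges G; f \<in> uedges G; v \<in> e; v \<in> f\<rbrakk> \<Longrightarrow>
      (inc_val X' e v - inc_val X e v) mod 3 = (inc_val X' f v - inc_val X f v) mod 3"
  shows "gamma_line X = gamma_line X'"
proof -
  have X: "mixed_graph X" "underlying X = G" and X': "mixed_graph X'" "underlying X' = G"
    using assms(1,2) by (auto simp: mixed_orientation_def)
  \<comment> \<open>The offset \<open>c\<close> is 1 for arcs and 0 for digons.\<close>
  have shift: "inc_val X f v mod 3 = (inc_val X e v + c) mod 3 \<longleftrightarrow>
      inc_val X' f v mod 3 = (inc_val X' e v + c) mod 3"
    if "e \<in> uedges G" "f \<in> uedges G" "v \<in> e \<inter> f" for e f v c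
  proof -
    have "3 dvd (inc_val X' e v - inc_val X e v) - (inc_val X' f v - inc_val X f v)"
      using diff[of e f v] that by (simp add: mod_eq_dvd_iff)
    then obtain k where "(inc_val X' e v - inc_val X e v) - (inc_val X' f v - inc_val X f v) = 3 * k"
      by (rule dvdE)
    then have "inc_val X' f v - (inc_val X' e v + c) = (inc_val X f v - (inc_val X e v + c)) + 3 * (- k)"
      by simp
    then show ?thesis
      unfolding mod_eq_dvd_iff by (simp only: dvd_add_left_iff[OF dvd_triv_left])
  qed
  have same: "inc_val X f v = inc_val X e v \<longleftrightarrow> inc_val X' f v = inc_val X' e v"
    if "e \<in> uedges G" "f \<in> uedges G" "v \<in> e \<inter> f" for e f v
    using shift[OF that, of 0] inc_val_mod_eqD[of X f v X e v] inc_val_mod_eqD[of X' f v X' e v]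
    by auto
  have "arcs (gamma_line X) = arcs (gamma_line X')"
    unfolding set_eq_iff split_paired_All arcs_gamma_line_iff[OF X(1)] arcs_gamma_line_iff[OF X'(1)]
      X(2) X'(2)
    using shift by blast
  moreover have "digons (gamma_line X) = digons (gamma_line X')"
    unfolding set_eq_iff digons_gamma_line_iff[OF X(1)] digons_gamma_line_iff[OF X'(1)] X(2) X'(2)
    by (intro allI bex_cong conj_cong refl same)
  moreover have "mverts (gamma_line X) = mverts (gamma_line X')"
    using X(2) X'(2) by (simp add: gamma_line_def)
  ultimately show ?thesis
    by simp
qed

text \<open>Distinct edges meet in at most one vertex, so the arcs between \<open>e\<close> and
  \<open>f\<close> in the line graph are decided at \<open>v\<close>. An arc in one direction, in
  the other, or in neither tells the three residues of the difference apart.\<close>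

lemma gamma_line_inc_val_diff:
  assumes "mixed_orientation X G" "mixed_orientation X' G" "gamma_line X = gamma_line X'"
    and ef: "e \<in> uedges G" "f \<in> uedges G" "v \<in> e" "v \<in> f"
  shows "(inc_val X' e v - inc_val X e v) mod 3 = (inc_val X' f v - inc_val X f v) mod 3"
proof (cases "e = f")
  case False
  have X: "mixed_graph X" "underlying X = G" and X': "mixed_graph X'" "underlying X' = G"
    using assms(1,2) by (auto simp: mixed_orientation_def)
  have "simple_graph G"
    using X by (simp add: mixed_graph_def)
  then have uniq: "e \<inter> f = {v}"
    using simple_graph_common_vertex ef False by fast
  have "inc_val X f v mod 3 = (inc_val X e v + 1) mod 3 \<longleftrightarrow>
      inc_val X' f v mod 3 = (inc_val X' e v + 1) mod 3"
    using arcs_gamma_line_iff[OF X(1), of e f] arcs_gamma_line_iff[OF X'(1), of e f]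
      X(2) X'(2) ef False assms(3) uniq by auto
  moreover have "inc_val X e v mod 3 = (inc_val X f v + 1) mod 3 \<longleftrightarrow>
      inc_val X' e v mod 3 = (inc_val X' f v + 1) mod 3"
    using arcs_gamma_line_iff[OF X(1), of f e] arcs_gamma_line_iff[OF X'(1), of f e]
      X(2) X'(2) ef False assms(3) uniq by (auto simp: Int_commute)
  ultimately show ?thesis
    using inc_val_range[of X e v] inc_val_range[of X f v]
      inc_val_range[of X' e v] inc_val_range[of X' f v]
    by (elim insertE emptyE) simp_all
qed simp

section \<open>Realisation of prescribed values\<close>

lemma orientation_of:
  assumes G: "simple_graph G"
    and anti: "\<And>u v. {u, v} \<in> uedges G \<Longrightarrow> (h {u, v} u + h {u, v} v) mod 3 = 0"
  shows "mixed_orientation (orientation_of G h) G"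
    and "e \<in> uedges G \<Longrightarrow> v \<in> e \<Longrightarrow> inc_val (orientation_of G h) e v mod 3 = h e v mod 3"
proof -
  let ?X = "orientation_of G h"
  \<comment> \<open>By \<open>anti\<close> the residue at \<open>u\<close> is the negative of that
    at \<open>v\<close>, so the value at \<open>v\<close> alone decides among digon and the two
    directions.\<close>
  have dig: "{u, v} \<in> digons ?X \<longleftrightarrow> h {u, v} v mod 3 = 0"
    and arc: "(u, v) \<in> arcs ?X \<longleftrightarrow> h {u, v} v mod 3 = 1"
    and arc': "(v, u) \<in> arcs ?X \<longleftrightarrow> h {u, v} v mod 3 = 2"
    if "{u, v} \<in> uedges G" for u v
  proof -
    show "(u, v) \<in> arcs ?X \<longleftrightarrow> h {u, v} v mod 3 = 1"
      using that by (simp add: orientation_of_def)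
    have "h {u, v} u mod 3 = 0 \<longleftrightarrow> h {u, v} v mod 3 = 0"
      "h {u, v} u mod 3 = 1 \<longleftrightarrow> h {u, v} v mod 3 = 2"
      using anti[OF that] by presburger+
    then show "{u, v} \<in> digons ?X \<longleftrightarrow> h {u, v} v mod 3 = 0"
      "(v, u) \<in> arcs ?X \<longleftrightarrow> h {u, v} v mod 3 = 2"
      using that by (auto simp: orientation_of_def insert_commute)
  qed
  have edge: "{u, v} \<in> uedges G" if "(u, v) \<in> arcs ?X" for u v
    using that by (simp add: orientation_of_def)
  have "uedges (underlying ?X) = uedges G"
  proof (intro set_eqI iffI)
    fix e
    assume e: "e \<in> uedges G"
    then have "card e = 2"
      using G by (simp add: simple_graph_def)
    then obtain u v where uv: "e = {u, v}"
      by (auto simp: card_2_iff)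
    have "h {u, v} v mod 3 = 0 \<or> h {u, v} v mod 3 = 1 \<or> h {u, v} v mod 3 = 2"
      by presburger
    then show "e \<in> uedges (underlying ?X)"
      using dig[of u v] arc[of u v] arc'[of u v] e uv
      by (auto simp: underlying_def insert_commute)
  next
    fix e
    assume "e \<in> uedges (underlying ?X)"
    then consider "e \<in> digons ?X" | u v where "e = {u, v}" "(u, v) \<in> arcs ?X"
      unfolding underlying_def ugraph.simps by blast
    then show "e \<in> uedges G"
    proof cases
      case 1
      then show ?thesis
        by (simp add: orientation_of_def)
    next
      case 2
      then show ?thesis
        using edge by simp
    qed
  qed
  then have und: "underlying ?X = G"
    by (simp add: underlying_def orientation_of_def)
  have "(v, u) \<notin> arcs ?X \<and> {u, v} \<notin> digons ?X" if "(u, v) \<in> arcs ?X" for u v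
    using dig[OF edge[OF that]] arc[OF edge[OF that]] arc'[OF edge[OF that]] that by simp
  then have mixed: "mixed_graph ?X"
    using G und by (simp add: mixed_graph_def)
  then show "mixed_orientation ?X G"
    using und by (simp add: mixed_orientation_def)
  assume e: "e \<in> uedges G" and "v \<in> e"
  then obtain u where uv: "e = {u, v}"
    using simple_graph_edgeE[OF G] by metis
  have one: "inc_val ?X e v = 1 \<longleftrightarrow> h e v mod 3 = 1"
    using arcs_iff_inc_val[OF mixed, of u v] arc e uv und by simp
  \<comment> \<open>Arcs are characterised by the value at the head, so a tail at \<open>v\<close>
    is detected as a head at \<open>u\<close>.\<close>
  have "inc_val ?X e v = -1 \<longleftrightarrow> inc_val ?X e u = 1"
    using inc_val_opposite[OF mixed, of u v] e uv und by auto
  also have "\<dots> \<longleftrightarrow> h e v mod 3 = 2"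
    using arcs_iff_inc_val[OF mixed, of v u] arc'[of u v] e uv und by (simp add: insert_commute)
  finally have minus: "inc_val ?X e v = -1 \<longleftrightarrow> h e v mod 3 = 2" .
  have "h e v mod 3 = 0 \<or> h e v mod 3 = 1 \<or> h e v mod 3 = 2"
    by presburger
  then show "inc_val ?X e v mod 3 = h e v mod 3"
    using one minus inc_val_range[of ?X e v] by (elim disjE insertE emptyE) simp_all
qed

section \<open>Propagation along a connected line graph\<close>

lemma connected_line_graph_induct:
  assumes conn: "connected_graph (line_graph G)"
    and "e0 \<in> uedges G" "P e0" "e \<in> uedges G"
    and step: "\<And>e f v. \<lbrakk>e \<in> uedges G; f \<in> uedges G; v \<in> e; v \<in> f; P e\<rbrakk> \<Longrightarrow> P f"
  shows "P e"
proof -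
  have "(e0, e) \<in> {(x, y). {x, y} \<in> uedges (line_graph G)}\<^sup>*"
    using assms by (simp add: connected_graph_def line_graph_def)
  then show ?thesis
  proof (induction rule: rtrancl_induct)
    case (step x y)
    then have "x \<in> uedges G \<and> y \<in> uedges G \<and> x \<inter> y \<noteq> {}"
      by (auto simp: line_graph_def doubleton_eq_iff)
    then show ?case
      using assms(5) step.IH by blast
  qed (rule \<open>P e0\<close>)
qed

text \<open>Agreement at one end of an edge passes to the other end by negation, and to every edge
  through a shared vertex because the discrepancy there is the same for all of them.\<close>

lemma gamma_line_orientations_eqI:
  assumes G: "connected_graph (line_graph G)"
    and X: "mixed_orientation X G" and X': "mixed_orientation X' G"
    and eq: "gamma_line X = gamma_line X'"
    and e0: "e0 \<in> uedges G" "v0 \<in> e0" "inc_val X e0 v0 = inc_val X' e0 v0"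
  shows "X = X'"
proof -
  have mixed: "mixed_graph X" "mixed_graph X'" and und: "underlying X = G" "underlying X' = G"
    using X X' by (auto simp: mixed_orientation_def)
  then have sg: "simple_graph G"
    by (auto simp: mixed_graph_def)
  let ?P = "\<lambda>e. \<forall>v \<in> e. inc_val X e v = inc_val X' e v"
  have edge: "?P e" if e: "e \<in> uedges G" "v \<in> e" "inc_val X e v = inc_val X' e v" for e v
  proof -
    obtain u where uv: "e = {u, v}"
      using simple_graph_edgeE[OF sg e(1,2)] by metis
    then have "inc_val X e u = inc_val X' e u"
      using inc_val_opposite[OF mixed(1), of u v] inc_val_opposite[OF mixed(2), of u v] e und
      by simp
    then show ?thesis
      using e uv by simp
  qed
  have "?P e" if "e \<in> uedges G" for e
  proof (rule connected_line_graph_induct[OF G e0(1) _ that])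
    show "?P e0"
      using edge e0 by blast
  next
    fix e f v
    assume ef: "e \<in> uedges G" "f \<in> uedges G" "v \<in> e" "v \<in> f" and "?P e"
    then have "(inc_val X' f v - inc_val X f v) mod 3 = 0"
      using gamma_line_inc_val_diff[OF X X' eq ef] by simp
    then have "inc_val X f v = inc_val X' f v"
      using inc_val_range[of X f v] inc_val_range[of X' f v] by auto
    then show "?P f"
      using edge ef by blast
  qed
  then show ?thesis
    using mixed_orientation_eqI[OF X X'] by blast
qed

section \<open>Bipartitions and shifts of the values\<close>

text \<open>The discrepancy of two different orientations vanishes nowhere and changes sign along
  each edge, so its sign is a proper 2-colouring.\<close>

lemma bipartite_if_two_gamma_line_orientations:
  assumes G: "connected_graph (line_graph G)"
    and X: "mixed_orientation X G" and X': "mixed_orientation X' G"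
    and eq: "gamma_line X = gamma_line X'" and "X \<noteq> X'"
  shows "bipartite G"
proof -
  have mixed: "mixed_graph X" "mixed_graph X'" and und: "underlying X = G" "underlying X' = G"
    using X X' by (auto simp: mixed_orientation_def)
  then have sg: "simple_graph G"
    by (auto simp: mixed_graph_def)
  define d where "d e v = (inc_val X' e v - inc_val X e v) mod 3" for e v
  have local: "d e v = d f v" if "e \<in> uedges G" "f \<in> uedges G" "v \<in> e" "v \<in> f" for e f v
    unfolding d_def using gamma_line_inc_val_diff[OF X X' eq that] .
  have nz: "d e v \<noteq> 0" if "e \<in> uedges G" "v \<in> e" for e v
  proof
    assume "d e v = 0"
    then have "inc_val X e v = inc_val X' e v"
      unfolding d_def using inc_val_range[of X e v] inc_val_range[of X' e v] by auto
    then show False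
      using gamma_line_orientations_eqI[OF G X X' eq that] \<open>X \<noteq> X'\<close> by blast
  qed
  \<comment> \<open>The choice of \<open>e\<close> is immaterial by \<open>local\<close>. Isolated
    vertices fall into the complement of \<open>A\<close>, so the two sides cover
    \<open>uverts G\<close>.\<close>
  define A where "A = {v \<in> uverts G. \<exists>e \<in> uedges G. v \<in> e \<and> d e v = 1}"
  have memA: "v \<in> A \<longleftrightarrow> d e v = 1" if "e \<in> uedges G" "v \<in> e" for e v
  proof -
    have "v \<in> uverts G"
      using that sg by (auto simp: simple_graph_def)
    moreover have "d f v = 1 \<longleftrightarrow> d e v = 1" if "f \<in> uedges G" "v \<in> f" for f
      using local[OF that(1) \<open>e \<in> uedges G\<close> that(2) \<open>v \<in> e\<close>] by simp
    ultimately show ?thesis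
      unfolding A_def using that by blast
  qed
  have "\<exists>a \<in> A. \<exists>b \<in> uverts G - A. e = {a, b}" if e: "e \<in> uedges G" for e
  proof -
    have "card e = 2" "e \<subseteq> uverts G"
      using e sg by (auto simp: simple_graph_def)
    then obtain u v where uv: "e = {u, v}" "u \<in> uverts G" "v \<in> uverts G"
      by (auto simp: card_2_iff)
    have "inc_val X e u = - inc_val X e v" "inc_val X' e u = - inc_val X' e v"
      using inc_val_opposite[OF mixed(1), of u v] inc_val_opposite[OF mixed(2), of u v] e und uv
      by auto
    then have "(d e u + d e v) mod 3 = 0"
      by (simp add: d_def mod_add_eq)
    moreover have "d e u \<noteq> 0" "d e v \<noteq> 0" "0 \<le> d e u" "d e u < 3" "0 \<le> d e v" "d e v < 3"
      using nz[OF e] uv by (auto simp: d_def)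
    \<comment> \<open>Two nonzero residues with sum 0 modulo 3 are 1 and 2 in some order.\<close>
    ultimately have "d e u = 1 \<and> d e v \<noteq> 1 \<or> d e u \<noteq> 1 \<and> d e v = 1"
      by presburger
    then show ?thesis
      using memA[OF e] uv by (auto simp: insert_commute)
  qed
  then show ?thesis
    unfolding bipartite_def
    by (intro exI[of _ A] exI[of _ "uverts G - A"]) (auto simp: A_def)
qed

text \<open>Adding \<open>c\<close> on one side of the bipartition and \<open>-c\<close> on the
  other keeps the values on each edge opposite and changes all values at a vertex by the same
  amount.\<close>

lemma exists_gamma_line_orientation_shift:
  assumes X: "mixed_orientation X G" and "bipartite G"
    and e0: "e0 \<in> uedges G" "v0 \<in> e0"
  obtains X' where "mixed_orientation X' G" "gamma_line X' = gamma_line X"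
    "inc_val X' e0 v0 mod 3 = (inc_val X e0 v0 + c) mod 3"
proof -
  have mixed: "mixed_graph X" and und: "underlying X = G"
    using X by (auto simp: mixed_orientation_def)
  then have sg: "simple_graph G"
    by (auto simp: mixed_graph_def)
  obtain A B where AB: "A \<inter> B = {}" and edge: "\<And>e. e \<in> uedges G \<Longrightarrow> \<exists>a \<in> A. \<exists>b \<in> B. e = {a, b}"
    using \<open>bipartite G\<close> by (auto simp: bipartite_def)
  \<comment> \<open>The sign is taken relative to the side of \<open>v0\<close>, so that
    \<open>p v0 = c\<close> in either case.\<close>
  define p where "p v = (if v \<in> A \<longleftrightarrow> v0 \<in> A then c else - c)" for v
  define h where "h e v = inc_val X e v + p v" for e v
  have anti: "(h {u, v} u + h {u, v} v) mod 3 = 0" if "{u, v} \<in> uedges G" for u v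
  proof -
    have "u \<in> A \<longleftrightarrow> v \<notin> A"
      using edge[OF that] AB by (auto simp: doubleton_eq_iff)
    then show ?thesis
      using inc_val_opposite[OF mixed, of u v] that und by (auto simp: h_def p_def)
  qed
  let ?X = "orientation_of G h"
  have X': "mixed_orientation ?X G"
    using orientation_of(1)[OF sg] anti by blast
  have val: "inc_val ?X e v mod 3 = h e v mod 3" if "e \<in> uedges G" "v \<in> e" for e v
    using orientation_of(2)[OF sg _ that] anti by blast
  have shift: "(inc_val ?X e v - inc_val X e v) mod 3 = p v mod 3"
    if "e \<in> uedges G" "v \<in> e" for e v
    using val[OF that] unfolding h_def by presburger
  have "gamma_line X = gamma_line ?X"
    using shift by (intro gamma_line_eqI[OF X X']) simp_all
  moreover have "inc_val ?X e0 v0 mod 3 = (inc_val X e0 v0 + c) mod 3"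
    using val[OF e0] by (simp add: h_def p_def)
  ultimately show thesis
    using that X' by simp
qed

section \<open>Counting the root orientations\<close>

theorem theorem15:
  fixes Y :: "'a set mgraph" and G :: "'a ugraph"
  assumes "is_gamma_line_graph Y"
    and "is_root G (underlying Y)"
    and "connected_graph (underlying Y)"
  shows "(bipartite G \<longrightarrow> card {X. mixed_orientation X G \<and> gamma_line X = Y} = 3) \<and>
    (\<not> bipartite G \<longrightarrow> (\<exists>!X. mixed_orientation X G \<and> gamma_line X = Y))"
proof -
  let ?S = "{X. mixed_orientation X G \<and> gamma_line X = Y}"
  obtain X0 where X0: "mixed_graph X0" "Y = gamma_line X0"
    using assms(1) by (auto simp: is_gamma_line_graph_def)
  have sg: "simple_graph G" and lg: "line_graph G = underlying Y"
    using assms(2) by (auto simp: is_root_def)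
  have conn: "connected_graph (line_graph G)"
    using assms(3) lg by simp
  have "line_graph G = line_graph (underlying X0)"
    using lg X0 underlying_gamma_line by simp
  then have edges: "uedges (underlying X0) = uedges G"
    by (simp add: line_graph_def)
  \<comment> \<open>\<open>X0\<close> and \<open>G\<close> have the same edges but may have different isolated vertices.\<close>
  define X1 where "X1 = X0\<lparr>mverts := uverts G\<rparr>"
  have und: "underlying X1 = G"
    using edges by (simp add: X1_def underlying_def)
  have X1: "mixed_orientation X1 G"
    using X0(1) sg und by (simp add: mixed_orientation_def mixed_graph_def X1_def)
  have "gamma_line X1 = Y"
    using edges und X0(2)
    by (simp add: X1_def gamma_line_def arc_with_head_def arc_with_tail_def digon_at_def)
  with X1 have X1S: "X1 \<in> ?S"
    by simp
  \<comment> \<open>A connected graph is nonempty by definition, so \<open>G\<close> has an edge to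
    serve as base point.\<close>
  obtain e0 where e0: "e0 \<in> uedges G"
    using conn by (auto simp: connected_graph_def line_graph_def)
  then have "card e0 = 2"
    using sg by (simp add: simple_graph_def)
  then obtain v0 where v0: "v0 \<in> e0"
    by (auto simp: card_2_iff)
  \<comment> \<open>The value at the base incidence determines the orientation by propagation, and
    shifts realise all three values.\<close>
  have "bij_betw (\<lambda>X. inc_val X e0 v0) ?S {-1, 0, 1}" if bip: "bipartite G"
    unfolding bij_betw_def
  proof (intro conjI inj_onI equalityI subsetI)
    fix X X'
    assume XS: "X \<in> ?S" "X' \<in> ?S" and "inc_val X e0 v0 = inc_val X' e0 v0"
    moreover have "gamma_line X = gamma_line X'"
      using XS by simp
    ultimately show "X = X'"
      using gamma_line_orientations_eqI[OF conn _ _ _ e0 v0] by blast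
  next
    fix c :: int
    assume c: "c \<in> {-1, 0, 1}"
    \<comment> \<open>The shift \<open>c - inc_val X1 e0 v0\<close> moves the base value of
      \<open>X1\<close> to \<open>c\<close>.\<close>
    obtain X where "mixed_orientation X G" "gamma_line X = gamma_line X1"
      and val: "inc_val X e0 v0 mod 3 = (inc_val X1 e0 v0 + (c - inc_val X1 e0 v0)) mod 3"
      using exists_gamma_line_orientation_shift[OF X1 bip e0 v0] by blast
    then have "X \<in> ?S"
      using X1S by simp
    moreover have "inc_val X e0 v0 = c"
      using val c inc_val_range[of X e0 v0] by auto
    ultimately show "c \<in> (\<lambda>X. inc_val X e0 v0) ` ?S"
      by blast
  next
    fix c
    assume "c \<in> (\<lambda>X. inc_val X e0 v0) ` ?S"
    then show "c \<in> {-1, 0, 1}"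
      by (elim imageE) (simp only: inc_val_range)
  qed
  then have "card ?S = 3" if "bipartite G"
    using bij_betw_same_card[of _ ?S "{-1, 0, 1 :: int}"] that by simp
  \<comment> \<open>A solution other than \<open>X1\<close> would force a bipartition of
    \<open>G\<close>.\<close>
  moreover have "\<exists>!X. X \<in> ?S" if "\<not> bipartite G"
  proof (rule ex1I, rule X1S)
    fix X
    assume "X \<in> ?S"
    moreover from this have "gamma_line X = gamma_line X1"
      using X1S by simp
    ultimately show "X = X1"
      using bipartite_if_two_gamma_line_orientations[OF conn _ X1] that by blast
  qed
  ultimately show ?thesis
    by simp
qed

end
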